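(* Let $\mathcal{G}=(\mathcal{N},\mathcal{X}=\prod_{i=1}^N\mathbb{R}^{n_i},\{u_i\}_{i=1}^N)$ be a $\lambda$-cocoercive continuous game ($\lambda>0$) whose set of Nash equilibria $\mathcal{X}^*$ is nonempty. Let $\eta\in(0,\lambda]$, let $\mathbf{x}_0\in\mathcal{X}$ be arbitrary, and let $(\mathbf{x}_t)_{t\ge 0}$ be the online gradient descent iterates with perfect feedback and constant step-size $\eta$, i.e. $\mathbf{x}_{t+1}=\mathbf{x}_t+\eta\,\mathbf{v}(\mathbf{x}_t)$ for all $t\ge 0$. Then $\epsilon(\mathbf{x}_T)=o(1/T)$ as $T\to\infty$.
   Context: A continuous game $\mathcal{G}=(\mathcal{N},\mathcal{X}=\prod_{i=1}^N\mathcal{X}_i,\{u_i\}_{i=1}^N)$ consists of a finite set of players $\mathcal{N}=\{1,\dots,N\}$, action sets $\mathcal{X}_i$ (here $\mathcal{X}_i=\mathbb{R}^{n_i}$), and payoff functions $u_i:\mathcal{X}\to\mathbb{R}$ such that each $u_i$ is continuous in $\mathbf{x}$, continuously differentiable in $x_i$, and the partial gradient $\nabla_{x_i}u_i(\mathbf{x})$ is Lipschitz continuous in $\mathbf{x}$. Write $v_i(\mathbf{x})=\nabla_{x_i}u_i(\mathbf{x})$ and $\mathbf{v}(\mathbf{x})=(v_1(\mathbf{x}),\dots,v_N(\mathbf{x}))$. A point $\mathbf{x}^*\in\mathcal{X}$ is a Nash equilibrium if for every $i$, $u_i(x_i^*,\mathbf{x}_{-i}^* )\ge u_i(x_i,\mathbf{x}_{-i}^*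 )$ for all $x_i\in\mathcal{X}_i$, where $\mathbf{x}_{-i}$ denotes the joint action of all players except $i$. The game is $\lambda$-cocoercive if $(\mathbf{x}'-\mathbf{x})^\top(\mathbf{v}(\mathbf{x}')-\mathbf{v}(\mathbf{x}))\le-\lambda\|\mathbf{v}(\mathbf{x}')-\mathbf{v}(\mathbf{x})\|^2$ for all $\mathbf{x},\mathbf{x}'\in\mathcal{X}$. The norm $\|\cdot\|$ is Euclidean, and $\epsilon(\mathbf{x})=\|\mathbf{v}(\mathbf{x})\|^2$. *)

theory Defs
  imports "HOL-Analysis.Analysis" "HOL-Library.Landau_Symbols"
begin

text \<open>
  The joint action space \<open>\<real>^{n_1} \<times> \<dots> \<times> \<real>^{n_N}\<close> is modelled as \<open>real ^ 'k\<close>: the players are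
  the elements of the finite type \<open>'p\<close>, the elements of \<open>'k\<close> are the scalar coordinates of a joint
  action, and a map \<open>own :: 'k \<Rightarrow> 'p\<close> assigns each coordinate to the player controlling it. Thus
  \<open>n_i = card {k. own k = i}\<close>, the dimensions \<open>n_i\<close> may differ between players, and every choice of
  \<open>N \<ge> 1\<close> and \<open>n_1, \<dots>, n_N \<ge> 1\<close> arises in this way
  (a player without coordinates, \<open>n_i = 0\<close>, is also permitted). The norm and inner product of \<open>real ^ 'k\<close> are
  the Euclidean ones of the product.
\<close>

text \<open>The joint action \<open>(y_i, x_{-i})\<close>; it depends on \<open>y\<close> only through the coordinates of player \<open>i\<close>.\<close>

definition deviate :: "('k::finite \<Rightarrow> 'p) \<Rightarrow> 'p \<Rightarrow> real ^ 'k \<Rightarrow> real ^ 'k \<Rightarrow> real ^ 'k" where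
  "deviate own i y x = (\<chi> k. if own k = i then y $ k else x $ k)"

text \<open>
  The gradient of \<open>f\<close> in the block \<open>x_i\<close> alone, embedded in the joint space: the differentiated map
  does not depend on the coordinates of the other players, so these components of the gradient
  vanish. Meaningful only if \<open>f\<close> is differentiable in \<open>x_i\<close> at \<open>x\<close>.
\<close>

definition partial_gradient ::
    "('k::finite \<Rightarrow> 'p) \<Rightarrow> 'p \<Rightarrow> (real ^ 'k \<Rightarrow> real) \<Rightarrow> real ^ 'k \<Rightarrow> real ^ 'k" where
  "partial_gradient own i f x = (THE D. GDERIV (\<lambda>y. f (deviate own i y x)) x :> D)"

definition continuous_game ::
    "('k::finite \<Rightarrow> 'p::finite) \<Rightarrow> ('p \<Rightarrow> real ^ 'k \<Rightarrow> real) \<Rightarrow> bool" where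
  "continuous_game own u \<longleftrightarrow> (\<forall>i.
     continuous_on UNIV (u i) \<and>
     (\<forall>x. (\<lambda>y. u i (deviate own i y x)) differentiable (at x)) \<and>
     (\<forall>x. continuous_on UNIV (\<lambda>y. partial_gradient own i (u i) (deviate own i y x))) \<and>
     (\<exists>L. L-lipschitz_on UNIV (partial_gradient own i (u i))))"

text \<open>The concatenation \<open>v = (v_1, \<dots>, v_N)\<close> of the players' own partial gradients.\<close>

definition game_gradient ::
    "('k::finite \<Rightarrow> 'p::finite) \<Rightarrow> ('p \<Rightarrow> real ^ 'k \<Rightarrow> real) \<Rightarrow> real ^ 'k \<Rightarrow> real ^ 'k" where
  "game_gradient own u x = (\<chi> k. partial_gradient own (own k) (u (own k)) x $ k)"

definition nash_equilibria ::
    "('k::finite \<Rightarrow> 'p::finite) \<Rightarrow> ('p \<Rightarrow> real ^ 'k \<Rightarrow> real) \<Rightarrow> (real ^ 'k) set" where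
  "nash_equilibria own u = {x. \<forall>i y. u i x \<ge> u i (deviate own i y x)}"

definition cocoercive_game ::
    "real \<Rightarrow> ('k::finite \<Rightarrow> 'p::finite) \<Rightarrow> ('p \<Rightarrow> real ^ 'k \<Rightarrow> real) \<Rightarrow> bool" where
  "cocoercive_game lam own u \<longleftrightarrow> continuous_game own u \<and>
     (\<forall>x x'. (x' - x) \<bullet> (game_gradient own u x' - game_gradient own u x)
        \<le> - lam * (norm (game_gradient own u x' - game_gradient own u x))\<^sup>2)"

definition game_error ::
    "('k::finite \<Rightarrow> 'p::finite) \<Rightarrow> ('p \<Rightarrow> real ^ 'k \<Rightarrow> real) \<Rightarrow> real ^ 'k \<Rightarrow> real" where
  "game_error own u x = (norm (game_gradient own u x))\<^sup>2"

end

theory Submission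
  imports Defs
begin

text \<open>
  At a Nash equilibrium \<open>x\<^sup>*\<close> the gradient vanishes, so cocoercivity against \<open>x\<^sup>*\<close> shows that
  \<open>\<parallel>x\<^sub>t - x\<^sup>*\<parallel>\<^sup>2\<close> drops by at least \<open>\<eta>\<^sup>2 \<epsilon>(x\<^sub>t)\<close> in each step; hence \<open>\<epsilon>(x\<^sub>t)\<close> is summable.
  Cocoercivity between consecutive iterates shows that \<open>\<epsilon>(x\<^sub>t)\<close> is nonincreasing, and a
  nonincreasing summable sequence is \<open>o(1/T)\<close>.
\<close>

text \<open>Each of the \<open>n - N\<close> terms with indices from \<open>N\<close> to
  \<open>n - 1\<close> is at least \<open>a n\<close>, so \<open>(n - N) * a n\<close> is bounded by
  a Cauchy block, and \<open>n - N\<close> is at least half of \<open>n\<close> for large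
  \<open>n\<close>.\<close>

lemma decseq_summable_smallo:
  fixes a :: "nat \<Rightarrow> real"
  assumes dec: "decseq a" and nonneg: "\<And>n. 0 \<le> a n" and sum: "summable a"
  shows "a \<in> o(\<lambda>n. 1 / real n)"
proof (rule landau_o.smallI)
  fix c :: real
  assume "c > 0"
  then obtain N where N: "\<And>m n. m \<ge> N \<Longrightarrow> norm (sum a {m..<n}) < c / 2"
    using sum[unfolded summable_Cauchy] by (meson half_gt_zero)
  show "eventually (\<lambda>n. norm (a n) \<le> c * norm (1 / real n)) sequentially"
    \<comment> \<open>The \<open>2 * N\<close> gives \<open>n - N \<ge> n / 2\<close>, whose factor
      2 is absorbed by the choice of \<open>c / 2\<close>. The extra 1 excludes
      \<open>n = 0\<close>, where \<open>1 / real n\<close> takes the default value 0.\<close>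
    using eventually_ge_at_top[of "2 * N + 1"]
  proof eventually_elim
    case (elim n)
    have "real (n - N) * a n = sum (\<lambda>_. a n) {N..<n}"
      by simp
    also have "\<dots> \<le> sum a {N..<n}"
      by (intro sum_mono decseqD[OF dec]) auto
    also have "\<dots> \<le> c / 2"
      using N[of N n] by simp
    finally have "real (n - N) * a n \<le> c / 2" .
    moreover have "real n / 2 * a n \<le> real (n - N) * a n"
      using elim by (intro mult_right_mono nonneg) (simp add: of_nat_diff)
    ultimately have "real n * a n \<le> c"
      by linarith
    then show ?case
      using elim nonneg[of n] by (simp add: field_simps)
  qed
qed

text \<open>Fermat's rule: freezing the other players' coordinates yields a function on the whole
  joint space with a global maximum at \<open>x\<close>, so its derivative there vanishes.\<close>

lemma partial_gradient_eq_0_at_max: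
  assumes diff: "(\<lambda>y. f (deviate own i y x)) differentiable (at x)"
    and max: "\<And>y. f (deviate own i y x) \<le> f x"
  shows "partial_gradient own i f x = 0"
proof -
  define g where "g = (\<lambda>y. f (deviate own i y x))"
  have "deviate own i x x = x"
    by (simp add: deviate_def vec_eq_iff)
  then have max': "g y \<le> g x" for y
    using max by (simp add: g_def)
  have zero: "g' = (\<lambda>_. 0)" if "(g has_derivative g') (at x)" for g'
    using differential_zero_maxmin[OF _ open_UNIV that] max' by blast
  \<comment> \<open>\<open>partial_gradient\<close> is a definite description, so both directions
    matter: the first gives uniqueness of the gradient, the second its existence, which rests on
    differentiability.\<close>
  have "GDERIV g x :> D \<longleftrightarrow> D = 0" for D
  proof
    assume "GDERIV g x :> D"
    then have "(\<lambda>h. h \<bullet> D) = (\<lambda>_. 0)"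
      by (intro zero) (simp add: gderiv_def)
    \<comment> \<open>Evaluate at \<open>h = D\<close>.\<close>
    then show "D = 0"
      by (metis inner_eq_zero_iff)
  next
    assume "D = 0"
    moreover obtain g' where "(g has_derivative g') (at x)"
      using diff by (auto simp: g_def differentiable_def)
    ultimately show "GDERIV g x :> D"
      using zero by (auto simp: gderiv_def)
  qed
  then show ?thesis
    by (simp add: partial_gradient_def flip: g_def)
qed

lemma game_gradient_nash_equilibrium:
  assumes "continuous_game own u" and "x \<in> nash_equilibria own u"
  shows "game_gradient own u x = 0"
proof -
  have "partial_gradient own i (u i) x = 0" for i
    using assms
    by (intro partial_gradient_eq_0_at_max) (auto simp: continuous_game_def nash_equilibria_def)
  then show ?thesis
    by (simp add: game_gradient_def vec_eq_iff)
qed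

text \<open>The displacement is \<open>\<eta> *\<^sub>R v x\<close>, so cocoercivity along the step
  controls the inner product of \<open>v x\<close> with the change \<open>d\<close> of
  \<open>v\<close>. This makes the error nonincreasing along the iterates.\<close>

lemma cocoercive_step_norm_le:
  fixes v :: "'a::real_inner \<Rightarrow> 'a"
  assumes coco: "\<And>x x'. (x' - x) \<bullet> (v x' - v x) \<le> - lam * (norm (v x' - v x))\<^sup>2"
    and "0 < \<eta>" "\<eta> \<le> lam"
  shows "norm (v (x + \<eta> *\<^sub>R v x)) \<le> norm (v x)"
proof -
  define d where "d = v (x + \<eta> *\<^sub>R v x) - v x"
  have "\<eta> * (v x \<bullet> d) \<le> - lam * (norm d)\<^sup>2"
    using coco[of "x + \<eta> *\<^sub>R v x" x] by (simp add: d_def)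
  also have "\<dots> \<le> \<eta> * - (norm d)\<^sup>2"
    using mult_right_mono[OF \<open>\<eta> \<le> lam\<close>, of "(norm d)\<^sup>2"] by simp
  finally have "v x \<bullet> d \<le> - (norm d)\<^sup>2"
    using \<open>0 < \<eta>\<close> by (rule mult_left_le_imp_le)
  moreover have "(norm (v x + d))\<^sup>2 = (norm (v x))\<^sup>2 + 2 * (v x \<bullet> d) + (norm d)\<^sup>2"
    by (simp add: power2_norm_eq_inner inner_add_left inner_add_right inner_commute)
  \<comment> \<open>The cross term is at most \<open>-2 * (norm d)\<^sup>2\<close>, which outweighs
    the quadratic term.\<close>
  ultimately have "(norm (v x + d))\<^sup>2 \<le> (norm (v x))\<^sup>2"
    using zero_le_power2[of "norm d"] by linarith
  then show ?thesis
    by (simp add: d_def power2_le_iff_abs_le)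
qed

text \<open>Cocoercivity against the zero \<open>z\<close> makes the cross term of the expanded
  square at most \<open>-2 * \<eta>\<^sup>2 * (norm (v x))\<^sup>2\<close>; the quadratic term takes
  back half of this.\<close>

lemma cocoercive_step_dist_le:
  fixes v :: "'a::real_inner \<Rightarrow> 'a"
  assumes coco: "\<And>x x'. (x' - x) \<bullet> (v x' - v x) \<le> - lam * (norm (v x' - v x))\<^sup>2"
    and "0 < \<eta>" "\<eta> \<le> lam" and "v z = 0"
  shows "(norm (x + \<eta> *\<^sub>R v x - z))\<^sup>2 \<le> (norm (x - z))\<^sup>2 - \<eta>\<^sup>2 * (norm (v x))\<^sup>2"
proof -
  have "(x - z) \<bullet> v x \<le> - lam * (norm (v x))\<^sup>2"
    using coco[of x z] \<open>v z = 0\<close> by simp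
  also have "\<dots> \<le> - \<eta> * (norm (v x))\<^sup>2"
    using mult_right_mono[OF \<open>\<eta> \<le> lam\<close>, of "(norm (v x))\<^sup>2"] by simp
  finally have "\<eta> * ((x - z) \<bullet> v x) \<le> \<eta> * (- \<eta> * (norm (v x))\<^sup>2)"
    using \<open>0 < \<eta>\<close> by (intro mult_left_mono) auto
  moreover have "(norm ((x - z) + \<eta> *\<^sub>R v x))\<^sup>2
      = (norm (x - z))\<^sup>2 + 2 * (\<eta> * ((x - z) \<bullet> v x)) + \<eta>\<^sup>2 * (norm (v x))\<^sup>2"
    unfolding power2_norm_eq_inner inner_add_left inner_add_right
    by (simp add: inner_commute power2_eq_square)
  ultimately show ?thesis
    by (simp add: algebra_simps power2_eq_square)
qed

theorem theorem3p3:
  fixes own :: "'k::finite \<Rightarrow> 'p::finite"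
    and u :: "'p \<Rightarrow> real ^ 'k \<Rightarrow> real"
    and lam \<eta> :: real
    and x :: "nat \<Rightarrow> real ^ 'k"
  assumes "lam > 0"
    and "cocoercive_game lam own u"
    and "nash_equilibria own u \<noteq> {}"
    and "0 < \<eta>" and "\<eta> \<le> lam"
    and "\<And>t. x (Suc t) = x t + \<eta> *\<^sub>R game_gradient own u (x t)"
  shows "(\<lambda>T. game_error own u (x T)) \<in> o(\<lambda>T. 1 / real T)"
proof (rule decseq_summable_smallo)
  define v where "v = game_gradient own u"
  have coco: "(y' - y) \<bullet> (v y' - v y) \<le> - lam * (norm (v y' - v y))\<^sup>2" for y y'
    using assms(2) by (simp add: cocoercive_game_def v_def)
  have step: "x (Suc t) = x t + \<eta> *\<^sub>R v (x t)" for t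
    using assms(6) by (simp add: v_def)
  obtain z where "z \<in> nash_equilibria own u"
    using assms(3) by blast
  then have z: "v z = 0"
    using assms(2) game_gradient_nash_equilibrium by (auto simp: cocoercive_game_def v_def)
  have err: "game_error own u y = (norm (v y))\<^sup>2" for y
    by (simp add: game_error_def v_def)
  show "decseq (\<lambda>T. game_error own u (x T))"
    unfolding err step decseq_Suc_iff
    using cocoercive_step_norm_le[OF coco \<open>0 < \<eta>\<close> \<open>\<eta> \<le> lam\<close>] by (auto intro: power_mono)
  show "0 \<le> game_error own u (x t)" for t
    by (simp add: err)
  \<comment> \<open>The one-step decreases telescope. Keeping the distance at time \<open>n\<close>
    lets the induction close; dropping it afterwards leaves a bound independent of
    \<open>n\<close>.\<close>
  have "(\<Sum>t<n. \<eta>\<^sup>2 * (norm (v (x t)))\<^sup>2) \<le> (norm (x 0 - z))\<^sup>2 - (norm (x n - z))\<^sup>2" for n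
  proof (induction n)
    case (Suc n)
    then show ?case
      using cocoercive_step_dist_le[OF coco \<open>0 < \<eta>\<close> \<open>\<eta> \<le> lam\<close> z, of "x n"]
      by (simp add: step)
  qed simp
  then have "(\<Sum>t<n. \<eta>\<^sup>2 * (norm (v (x t)))\<^sup>2) \<le> (norm (x 0 - z))\<^sup>2" for n
    by (rule order_trans) simp
  then have "summable (\<lambda>t. \<eta>\<^sup>2 * (norm (v (x t)))\<^sup>2)"
    by (intro summableI_nonneg_bounded) auto
  then show "summable (\<lambda>T. game_error own u (x T))"
    using \<open>0 < \<eta>\<close> by (simp add: err summable_cmult_iff)
qed

end
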